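(* Let $f \in \mathbb{C}[z_1,\ldots,z_n]$ be a non-constant polynomial with homogenization $f_h \in \mathbb{C}[z_0,z_1,\ldots,z_n]$. If $f_h$ has a zero $(0:p_1:\cdots:p_n) \in \mathbb{P}^n_{\mathbb{C}}$, then, with $\mathbf{p} = (p_1,\ldots,p_n)$ and $$\mathcal{H} = \{\lambda \operatorname{Re}(\mathbf{p}) + \mu \operatorname{Im}(\mathbf{p}) : \lambda,\mu \in \mathbb{R}\} \subseteq \mathbb{R}^n,$$ every point of $\mathbb{S}^{n-1} \cap \mathcal{H}$ is a limit direction of the imaginary projection of $f$, i.e. $\mathbb{S}^{n-1} \cap \mathcal{H} \subseteq \mathcal{I}_\infty(f)$.
   Context: For $f \in \mathbb{C}[z_1,\ldots,z_n]$, the imaginary projection of $f$ is $\mathcal{I}(f) = \{\operatorname{Im}(\mathbf{z}) : \mathbf{z} \in \mathbb{C}^n,\ f(\mathbf{z}) = 0\} \subseteq \mathbb{R}^n$; real and imaginary parts of vectors are taken componentwise. $\mathbb{S}^{n-1}$ is the Euclidean unit sphere in $\mathbb{R}^n$. The set of limit directions is $\mathcal{I}_\infty(f) = \lim_{r \to \infty}\left(\frac1r \mathcal{I}(f) \cap \mathbb{S}^{n-1}\right)$, meaning the set of limit points, as $r \to \infty$, of points of $\frac1r \mathcal{I}(f) \cap \mathbb{S}^{n-1}$: $\mathbf{q} \in \mathcal{I}_\infty(f)$ iff there are real $r_k \to \infty$ and $\mathbf{q}_k \in \frac{1}{r_k}\mathcal{I}(f) \cap \mathbb{S}^{n-1}$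 with $\mathbf{q}_k \to \mathbf{q}$. The homogenization of $f$ of total degree $d$ is $f_h(z_0,\mathbf{z}) = z_0^d f(z_1/z_0,\ldots,z_n/z_0)$. *)

theory Defs
  imports "HOL-Analysis.Analysis" "HOL-Library.Poly_Mapping"
begin

text \<open>
  \<^typ>\<open>('v \<Rightarrow>\<^sub>0 nat) \<Rightarrow>\<^sub>0 complex\<close> is the ring of polynomials over \<open>\<complex>\<close> in the
  variables \<^typ>\<open>'v\<close>: a polynomial maps exponent vectors to coefficients, and its ring structure is
  that of \<^theory>\<open>HOL-Library.Poly_Mapping\<close>. With \<^typ>\<open>'n::finite\<close> for the variables
  \<open>z_1, \<dots>, z_n\<close>, the variables \<open>z_0, z_1, \<dots>, z_n\<close> of the homogenization are
  \<^typ>\<open>'n option\<close>, with \<open>z_0\<close> being \<^term>\<open>None\<close>.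
\<close>

type_synonym 'v mpoly = "('v \<Rightarrow>\<^sub>0 nat) \<Rightarrow>\<^sub>0 complex"

definition mpoly_const :: "complex \<Rightarrow> 'v mpoly" where
  "mpoly_const c = Poly_Mapping.single 0 c"

definition mpoly_eval :: "'v::finite mpoly \<Rightarrow> complex ^ 'v \<Rightarrow> complex" where
  "mpoly_eval f z =
     (\<Sum>m\<in>Poly_Mapping.keys f. Poly_Mapping.lookup f m * (\<Prod>i\<in>UNIV. (z $ i) ^ Poly_Mapping.lookup m i))"

definition mono_degree :: "('v::finite \<Rightarrow>\<^sub>0 nat) \<Rightarrow> nat" where
  "mono_degree m = (\<Sum>i\<in>UNIV. Poly_Mapping.lookup m i)"

text \<open>The \<^term>\<open>insert 0\<close> only serves to give the zero polynomial degree 0.\<close>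

definition total_degree :: "'v::finite mpoly \<Rightarrow> nat" where
  "total_degree f = Max (insert 0 (mono_degree ` Poly_Mapping.keys f))"

definition homogenize_mono :: "nat \<Rightarrow> ('n::finite \<Rightarrow>\<^sub>0 nat) \<Rightarrow> ('n option \<Rightarrow>\<^sub>0 nat)" where
  "homogenize_mono d m =
     Poly_Mapping.single None (d - mono_degree m) +
     (\<Sum>i\<in>UNIV. Poly_Mapping.single (Some i) (Poly_Mapping.lookup m i))"

definition homogenization :: "'n::finite mpoly \<Rightarrow> 'n option mpoly" where
  "homogenization f =
     (\<Sum>m\<in>Poly_Mapping.keys f.
        Poly_Mapping.single (homogenize_mono (total_degree f) m) (Poly_Mapping.lookup f m))"

text \<open>The vector \<open>(z_0, z_1, \<dots>, z_n)\<close>; it represents the point \<open>(z_0 : z_1 : \<dots> : z_n)\<close> of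
  projective space precisely when it is nonzero.\<close>

definition hcoords :: "complex \<Rightarrow> complex ^ 'n::finite \<Rightarrow> complex ^ ('n option)" where
  "hcoords z0 z = (\<chi> j. case j of None \<Rightarrow> z0 | Some i \<Rightarrow> z $ i)"

definition Re_vec :: "complex ^ 'n \<Rightarrow> real ^ 'n" where
  "Re_vec z = (\<chi> i. Re (z $ i))"

definition Im_vec :: "complex ^ 'n \<Rightarrow> real ^ 'n" where
  "Im_vec z = (\<chi> i. Im (z $ i))"

definition imaginary_projection :: "'n::finite mpoly \<Rightarrow> (real ^ 'n) set" where
  "imaginary_projection f = {Im_vec z | z. mpoly_eval f z = 0}"

text \<open>A term with \<open>r k = 0\<close> cannot occur: the scaled set would be contained in \<open>{0}\<close>, which misses
  the unit sphere.\<close>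

definition limit_directions :: "'n::finite mpoly \<Rightarrow> (real ^ 'n) set" where
  "limit_directions f =
     {q. \<exists>(r :: nat \<Rightarrow> real) (s :: nat \<Rightarrow> real ^ 'n).
           filterlim r at_top sequentially \<and>
           (\<forall>k. s k \<in> (\<lambda>y. (1 / r k) *\<^sub>R y) ` imaginary_projection f \<inter> sphere 0 1) \<and>
           s \<longlonglongrightarrow> q}"

lemma mpoly_eval_superset:
  assumes "finite A" "Poly_Mapping.keys f \<subseteq> A"
  shows "mpoly_eval f z =
    (\<Sum>m\<in>A. Poly_Mapping.lookup f m * (\<Prod>i\<in>UNIV. (z $ i) ^ Poly_Mapping.lookup m i))"
  unfolding mpoly_eval_def using assms
  by (intro sum.mono_neutral_left) (auto simp: in_keys_iff)

lemma mpoly_eval_0 [simp]: "mpoly_eval 0 z = 0"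
  by (simp add: mpoly_eval_def)

lemma mpoly_eval_single:
  "mpoly_eval (Poly_Mapping.single m c) z = c * (\<Prod>i\<in>UNIV. (z $ i) ^ Poly_Mapping.lookup m i)"
  by (subst mpoly_eval_superset[of "{m}"]) auto

lemma mpoly_eval_add: "mpoly_eval (f + g) z = mpoly_eval f z + mpoly_eval g z"
proof -
  let ?A = "Poly_Mapping.keys f \<union> Poly_Mapping.keys g"
  have "Poly_Mapping.keys (f + g) \<subseteq> ?A" by (rule Poly_Mapping.keys_add)
  then show ?thesis
    by (simp add: mpoly_eval_superset[of ?A] lookup_add algebra_simps sum.distrib)
qed

lemma mpoly_eval_sum: "mpoly_eval (\<Sum>a\<in>A. f a) z = (\<Sum>a\<in>A. mpoly_eval (f a) z)"
  by (induction A rule: infinite_finite_induct) (auto simp: mpoly_eval_add)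

lemma lookup_homogenize_mono:
  "Poly_Mapping.lookup (homogenize_mono d m) None = d - mono_degree m"
  "Poly_Mapping.lookup (homogenize_mono d m) (Some i) = Poly_Mapping.lookup m i"
  by (auto simp: homogenize_mono_def lookup_add lookup_sum lookup_single when_def sum.delta)

lemma mono_degree_le_total_degree:
  "m \<in> Poly_Mapping.keys f \<Longrightarrow> mono_degree m \<le> total_degree f"
  unfolding total_degree_def by (intro Max_ge) auto

lemma prod_UNIV_option:
  fixes g :: "'n::finite option \<Rightarrow> 'a::comm_monoid_mult"
  shows "(\<Prod>j\<in>UNIV. g j) = g None * (\<Prod>i\<in>UNIV. g (Some i))"
  by (simp add: UNIV_option_conv prod.reindex)

lemma mpoly_eval_homogenization_general:
  "mpoly_eval (homogenization f) (hcoords z0 z) =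
     (\<Sum>m\<in>Poly_Mapping.keys f. Poly_Mapping.lookup f m *
        (z0 ^ (total_degree f - mono_degree m) * (\<Prod>i\<in>UNIV. (z $ i) ^ Poly_Mapping.lookup m i)))"
  by (simp add: homogenization_def mpoly_eval_sum mpoly_eval_single prod_UNIV_option
      lookup_homogenize_mono hcoords_def)

text \<open>The defining property \<open>f_h(z_0, z) = z_0^d f(z_1/z_0, \<dots>, z_n/z_0)\<close>.\<close>

lemma mpoly_eval_homogenization:
  assumes "z0 \<noteq> 0"
  shows "mpoly_eval (homogenization f) (hcoords z0 z) =
           z0 ^ total_degree f * mpoly_eval f (\<chi> i. z $ i / z0)"
proof -
  have "z0 ^ (total_degree f - mono_degree m) * (\<Prod>i\<in>UNIV. (z $ i) ^ Poly_Mapping.lookup m i) =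
        z0 ^ total_degree f * (\<Prod>i\<in>UNIV. (z $ i / z0) ^ Poly_Mapping.lookup m i)"
    if "m \<in> Poly_Mapping.keys f" for m
  proof -
    have "(\<Prod>i\<in>UNIV. (z $ i / z0) ^ Poly_Mapping.lookup m i) =
          (\<Prod>i\<in>UNIV. (z $ i) ^ Poly_Mapping.lookup m i) / z0 ^ mono_degree m"
      by (simp add: power_divide prod_dividef mono_degree_def power_sum)
    then show ?thesis
      using assms mono_degree_le_total_degree[OF that] by (simp add: power_diff)
  qed
  then show ?thesis
    unfolding mpoly_eval_homogenization_general
    by (simp add: mpoly_eval_def sum_distrib_left mult.left_commute cong: sum.cong)
qed

end

theory Submission
  imports Defs "HOL-Complex_Analysis.Great_Picard"
begin

text \<open>
  A point \<open>q\<close> of \<open>\<H>\<close> is \<open>Im w\<close> for some complex multiple \<open>w\<close> of \<open>p\<close>, and \<open>f_h(0, w) = 0\<close> by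
  homogeneity. Choose \<open>v\<close> with \<open>f_h(0, v) \<noteq> 0\<close>. The entire functions \<open>s \<mapsto> f_h(t, w + s v)\<close>
  converge locally uniformly as \<open>t \<rightarrow> 0\<close> to a function that vanishes at \<open>s = 0\<close> but not identically,
  so by Hurwitz's theorem \<open>f_h\<close> has zeros \<open>(t, u)\<close> with \<open>t > 0\<close> arbitrarily close to \<open>(0, w)\<close>. Then
  \<open>u / t\<close> is a zero of \<open>f\<close>, and since \<open>t\<close> is real its imaginary part has the direction of \<open>Im u\<close>,
  which tends to \<open>q\<close>, while its norm tends to infinity.
\<close>

section \<open>The form of top degree and its values\<close>

text \<open>Grouping the terms by their exponent in one variable gives a univariate polynomial that
  vanishes everywhere, so each group vanishes as a function of the remaining variables; induction on
  \<open>A\<close> then applies to each group in place of \<open>S\<close>.\<close>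

lemma vanishing_polynomial_coeffs:
  fixes c :: "('v \<Rightarrow>\<^sub>0 nat) \<Rightarrow> complex"
  assumes "finite A" "finite S"
    and "\<And>x. (\<Sum>m\<in>S. c m * (\<Prod>i\<in>A. x i ^ Poly_Mapping.lookup m i)) = 0"
  shows "(\<Sum>m | m \<in> S \<and> (\<forall>i\<in>A. Poly_Mapping.lookup m i = Poly_Mapping.lookup e i). c m) = 0"
  using assms
proof (induction A arbitrary: S rule: finite_induct)
  case empty
  then show ?case by simp
next
  case (insert j A)
  let ?S = "\<lambda>k. {m \<in> S. Poly_Mapping.lookup m j = k}"
  let ?N = "Max ((\<lambda>m. Poly_Mapping.lookup m j) ` S)"
  have "(\<Sum>m\<in>?S k. c m * (\<Prod>i\<in>A. x i ^ Poly_Mapping.lookup m i)) = 0" for x k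
  proof -
    \<comment> \<open>For fixed \<open>x\<close>, \<open>a k\<close> is the coefficient of
      \<open>y ^ k\<close> once \<open>x j\<close> is replaced by \<open>y\<close>; since
      \<open>j\<close> is not in \<open>A\<close>, the replacement leaves \<open>a k\<close>
      alone.\<close>
    define a where "a k = (\<Sum>m\<in>?S k. c m * (\<Prod>i\<in>A. x i ^ Poly_Mapping.lookup m i))" for k
    have le: "Poly_Mapping.lookup m j \<le> ?N" if "m \<in> S" for m
      using that insert.prems by (intro Max_ge) auto
    have "(\<Sum>k\<le>?N. a k * y ^ k) = 0" for y
    proof -
      have 1: "(\<Prod>i\<in>A. (x(j := y)) i ^ Poly_Mapping.lookup m i)
          = (\<Prod>i\<in>A. x i ^ Poly_Mapping.lookup m i)" for m
        using insert.hyps by (intro prod.cong) auto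
      have "(\<Sum>k\<le>?N. a k * y ^ k)
          = (\<Sum>k\<le>?N. \<Sum>m\<in>?S k. c m * (\<Prod>i\<in>insert j A. (x(j := y)) i ^ Poly_Mapping.lookup m i))"
        unfolding a_def sum_distrib_right using insert.hyps 1
        by (intro sum.cong refl) (auto simp: mult_ac simp del: fun_upd_apply simp: fun_upd_same)
      also have "\<dots> = (\<Sum>m\<in>S. c m * (\<Prod>i\<in>insert j A. (x(j := y)) i ^ Poly_Mapping.lookup m i))"
        using insert.prems(1) le by (intro sum.group) auto
      also have "\<dots> = 0"
        by (rule insert.prems(2))
      finally show ?thesis .
    qed
    then have "\<forall>k\<le>?N. a k = 0"
      using polyfun_eq_0[of a ?N] by blast
    moreover have "a k = 0" if "k > ?N"
    proof -
      have "?S k = {}" using le that by fastforce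
      then show ?thesis unfolding a_def by (simp only: sum.empty)
    qed
    ultimately show ?thesis
      unfolding a_def by (meson not_le)
  qed
  then have "(\<Sum>m | m \<in> ?S (Poly_Mapping.lookup e j) \<and>
      (\<forall>i\<in>A. Poly_Mapping.lookup m i = Poly_Mapping.lookup e i). c m) = 0"
    using insert.prems(1) by (intro insert.IH) auto
  then show ?case
      by simp
qed

text \<open>At \<open>z0 = 0\<close> a term survives only if its power of \<open>z0\<close> has
  exponent 0, where \<open>0 ^ 0 = 1\<close>.\<close>

lemma mpoly_eval_homogenization_infinity:
  "mpoly_eval (homogenization f) (hcoords 0 z) =
     (\<Sum>m | m \<in> Poly_Mapping.keys f \<and> mono_degree m = total_degree f.
        Poly_Mapping.lookup f m * (\<Prod>i\<in>UNIV. (z $ i) ^ Poly_Mapping.lookup m i))"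
  unfolding mpoly_eval_homogenization_general
  by (rule sum.mono_neutral_cong_right)
    (auto simp: zero_power dest: mono_degree_le_total_degree)

text \<open>The top form contains a monomial \<open>e\<close> with nonzero coefficient. If all its
  values were 0, comparing exponents in all variables would single out \<open>e\<close> and force
  that coefficient to be 0.\<close>

lemma homogenization_nonzero_at_infinity:
  fixes f :: "'n::finite mpoly"
  assumes "f \<noteq> 0"
  obtains v where "mpoly_eval (homogenization f) (hcoords 0 v) \<noteq> 0"
proof -
  let ?K = "Poly_Mapping.keys f"
  let ?S = "{m \<in> ?K. mono_degree m = total_degree f}"
  have K: "?K \<noteq> {}" using assms by simp
  have "total_degree f = Max (mono_degree ` ?K)"
    unfolding total_degree_def using K by (subst Max_insert) auto
  then have "total_degree f \<in> mono_degree ` ?K"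
    using K by (metis Max_in finite_imageI finite_keys image_is_empty)
  then obtain e where e: "e \<in> ?S" by auto
  have "\<exists>v. mpoly_eval (homogenization f) (hcoords 0 v) \<noteq> 0"
  proof (rule ccontr)
    assume "\<not> ?thesis"
    then have *: "mpoly_eval (homogenization f) (hcoords 0 (\<chi> i. x i)) = 0" for x
      by blast
    have "(\<Sum>m | m \<in> ?S \<and> (\<forall>i\<in>UNIV. Poly_Mapping.lookup m i = Poly_Mapping.lookup e i).
        Poly_Mapping.lookup f m) = 0"
      using *[unfolded mpoly_eval_homogenization_infinity]
      by (intro vanishing_polynomial_coeffs) simp_all
    moreover have "{m. m \<in> ?S \<and> (\<forall>i\<in>UNIV. Poly_Mapping.lookup m i = Poly_Mapping.lookup e i)} = {e}"
    proof -
      have "m = e" if "\<forall>i. Poly_Mapping.lookup m i = Poly_Mapping.lookup e i" for m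
        using that by (intro poly_mapping_eqI) auto
      then show ?thesis using e by blast
    qed
    ultimately show False
      using e by (simp add: in_keys_iff)
  qed
  then show ?thesis using that by blast
qed

lemma mpoly_eval_homogenization_infinity_scale:
  "mpoly_eval (homogenization f) (hcoords 0 (c *s z)) =
     c ^ total_degree f * mpoly_eval (homogenization f) (hcoords 0 z)"
  unfolding mpoly_eval_homogenization_infinity sum_distrib_left
  by (intro sum.cong refl)
    (auto simp: power_mult_distrib prod.distrib mono_degree_def power_sum[symmetric] mult_ac)

section \<open>Persistence of zeros under perturbation\<close>

text \<open>If no such zero existed, Hurwitz's theorem along a sequence of positive \<open>t\<close>
  tending to 0 would make the nonconstant limit \<open>g 0\<close> free of zeros near
  \<open>a\<close>. The point \<open>b\<close> may lie far from \<open>a\<close>: the identity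
  theorem links the two.\<close>

lemma zero_persists:
  fixes g :: "real \<Rightarrow> complex \<Rightarrow> complex"
  assumes cont: "continuous_on UNIV (\<lambda>(t, s). g t s)"
    and holo: "\<And>t. g t holomorphic_on UNIV"
    and zero: "g 0 a = 0" and nonzero: "g 0 b \<noteq> 0" and "\<epsilon> > 0"
  obtains t s where "0 < t" "t < \<epsilon>" "dist s a < \<epsilon>" "g t s = 0"
proof -
  have "\<exists>t s. 0 < t \<and> t < \<epsilon> \<and> dist s a < \<epsilon> \<and> g t s = 0"
  proof (rule ccontr)
    assume contra: "\<not> ?thesis"
    define T where "T n = \<epsilon> / real (n + 2)" for n
    have T: "0 < T n" "T n < \<epsilon>" for n
      using \<open>\<epsilon> > 0\<close> by (auto simp: T_def pos_divide_less_eq)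
    have T_lim: "T \<longlonglongrightarrow> 0"
      unfolding T_def by real_asymp
    have "g 0 a \<noteq> 0"
    proof (rule Hurwitz_no_zeros[of "ball a \<epsilon>" "\<lambda>n. g (T n)" "g 0" a])
      show "\<And>n. g (T n) holomorphic_on ball a \<epsilon>" "g 0 holomorphic_on ball a \<epsilon>"
        using holo holomorphic_on_subset by blast+
      show "\<not> g 0 constant_on ball a \<epsilon>"
      proof
        assume "g 0 constant_on ball a \<epsilon>"
        then have "g 0 z = 0" if "z \<in> ball a \<epsilon>" for z
          using that zero \<open>\<epsilon> > 0\<close> unfolding constant_on_def by (metis centre_in_ball)
        then have "g 0 b = (\<lambda>_. 0) b"
          by (intro analytic_continuation_open[of "ball a \<epsilon>" UNIV "g 0" "\<lambda>_. 0" b, OF _ _ _ _ _ holo])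
            (use \<open>\<epsilon> > 0\<close> in auto)
        then show False using nonzero by simp
      qed
      show "g (T n) z \<noteq> 0" if "z \<in> ball a \<epsilon>" for n z
        using contra T[of n] that by (auto simp: dist_commute)
      show "uniform_limit K (\<lambda>n. g (T n)) (g 0) sequentially"
        if K: "compact K" "K \<subseteq> ball a \<epsilon>" for K
      proof (rule uniform_limitI)
        fix e :: real assume "e > 0"
        \<comment> \<open>Joint continuity and compactness of \<open>K\<close> give one
          neighbourhood of \<open>t = 0\<close> that serves all of \<open>K\<close>;
          \<open>e / 2\<close> turns the weak bound into a strict one.\<close>
        obtain X where X: "0 \<in> X" "open X"
          "\<forall>t\<in>X \<inter> UNIV. \<forall>z\<in>K. dist (g t z) (g 0 z) \<le> e / 2"
          by (rule continuous_on_prod_compactE[of UNIV K "\<lambda>(t, s). g t s" 0 "e / 2"])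
            (use K \<open>e > 0\<close> in \<open>auto intro: continuous_on_subset[OF cont]\<close>)
        have "\<forall>\<^sub>F n in sequentially. T n \<in> X"
          using topological_tendstoD[OF T_lim X(2,1)] .
        then show "\<forall>\<^sub>F n in sequentially. \<forall>z\<in>K. dist (g (T n) z) (g 0 z) < e"
          by eventually_elim (use X(3) \<open>e > 0\<close> in fastforce)
      qed
    qed (use \<open>\<epsilon> > 0\<close> in auto)
    with zero show False by simp
  qed
  then show ?thesis using that by blast
qed

text \<open>Restricting to the complex line through \<open>w\<close> in direction \<open>v\<close>
  reduces the claim to one complex variable.\<close>

lemma homogenization_zero_near_infinity:
  fixes f :: "'n::finite mpoly" and w :: "complex ^ 'n"
  assumes "f \<noteq> 0" and zero: "mpoly_eval (homogenization f) (hcoords 0 w) = 0" and "\<epsilon> > 0"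
  obtains t :: real and u where "0 < t" "t < \<epsilon>" "dist u w < \<epsilon>"
    "mpoly_eval (homogenization f) (hcoords (of_real t) u) = 0"
proof -
  let ?F = "\<lambda>t z. mpoly_eval (homogenization f) (hcoords t z)"
  obtain v where v: "?F 0 v \<noteq> 0"
    using homogenization_nonzero_at_infinity[OF \<open>f \<noteq> 0\<close>] .
  define g where "g = (\<lambda>(t::real) s. ?F (of_real t) (w + s *s v))"
  have g: "g = (\<lambda>t s. \<Sum>m\<in>Poly_Mapping.keys f. Poly_Mapping.lookup f m *
        (of_real t ^ (total_degree f - mono_degree m) *
          (\<Prod>i\<in>UNIV. (w $ i + s * v $ i) ^ Poly_Mapping.lookup m i)))"
    unfolding g_def mpoly_eval_homogenization_general by simp
  have cont: "continuous_on UNIV (\<lambda>(t, s). g t s)"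
    unfolding g case_prod_unfold by (intro continuous_intros)
  have holo: "g t holomorphic_on UNIV" for t
    unfolding g by (intro holomorphic_intros)
  have "\<exists>b. g 0 b \<noteq> 0"
    \<comment> \<open>for \<open>x\<close> near 0, \<open>x w + v\<close> is a nonzero of the top form, and \<open>w + v / x\<close> is a multiple of it\<close>
  proof -
    have "continuous_on UNIV (\<lambda>x. ?F 0 (x *s w + v))"
      unfolding mpoly_eval_homogenization_general
      by (auto intro!: continuous_intros)
    then have "isCont (\<lambda>x. ?F 0 (x *s w + v)) 0"
      using continuous_on_eq_continuous_at[OF open_UNIV] by blast
    then have "((\<lambda>x. ?F 0 (x *s w + v)) \<longlongrightarrow> ?F 0 (0 *s w + v)) (at 0)"
      by (rule isContD)
    then have "\<forall>\<^sub>F x in at 0. ?F 0 (x *s w + v) \<noteq> 0"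
      using v by (intro tendsto_imp_eventually_ne) auto
    moreover have "\<forall>\<^sub>F x in at (0::complex). x \<noteq> 0"
      by (simp add: eventually_at_filter)
    ultimately have "\<forall>\<^sub>F x in at (0::complex). ?F 0 (x *s w + v) \<noteq> 0 \<and> x \<noteq> 0"
      by eventually_elim auto
    then obtain x :: complex where x: "?F 0 (x *s w + v) \<noteq> 0" "x \<noteq> 0"
      using eventually_happens'[OF at_neq_bot] by blast
    have "w + (1 / x) *s v = (1 / x) *s (x *s w + v)"
      using x(2) by (simp add: vec_eq_iff field_simps)
    then have "g 0 (1 / x) = (1 / x) ^ total_degree f * ?F 0 (x *s w + v)"
      unfolding g_def of_real_0 by (simp only: mpoly_eval_homogenization_infinity_scale)
    then have "g 0 (1 / x) \<noteq> 0"
      using x by simp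
    then show ?thesis ..
  qed
  then obtain b where b: "g 0 b \<noteq> 0" ..
  have g0: "g 0 0 = 0" using zero by (simp add: g_def)
  \<comment> \<open>The second bound ensures \<open>norm (s *s v) < \<epsilon>\<close>; adding 1
    keeps the denominator positive.\<close>
  define \<delta> where "\<delta> = min \<epsilon> (\<epsilon> / (norm v + 1))"
  have "\<delta> > 0" using \<open>\<epsilon> > 0\<close> by (simp add: \<delta>_def add_nonneg_pos)
  from zero_persists[OF cont holo g0 b this] obtain t s
    where ts: "0 < t" "t < \<delta>" "norm s < \<delta>" "g t s = 0" by auto
  have "norm (s *s v) = norm s * norm v"
    by (simp add: norm_vec_def norm_mult L2_set_right_distrib)
  also have "\<dots> \<le> norm s * (norm v + 1)"
    by (simp add: mult_left_mono)
  also have "\<dots> < \<epsilon>"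
    using ts(3) by (simp add: \<delta>_def pos_less_divide_eq add_nonneg_pos)
  finally have "dist (w + s *s v) w < \<epsilon>"
    by (simp add: dist_norm)
  with ts show ?thesis
    by (intro that[of t "w + s *s v"]) (auto simp: g_def \<delta>_def)
qed

section \<open>From zeros near infinity to limit directions\<close>

lemma norm_Im_vec_le: "norm (Im_vec z) \<le> norm z"
  unfolding norm_vec_def Im_vec_def
  by (intro L2_set_mono) (auto simp: abs_Im_le_cmod)

lemma Im_vec_diff: "Im_vec (x - y) = Im_vec x - Im_vec y"
  by (simp add: Im_vec_def vec_eq_iff)

lemma limit_direction_of_zero_at_infinity:
  fixes f :: "'n::finite mpoly" and w :: "complex ^ 'n"
  assumes "f \<noteq> 0" and zero: "mpoly_eval (homogenization f) (hcoords 0 w) = 0"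
    and unit: "norm (Im_vec w) = 1"
  shows "Im_vec w \<in> limit_directions f"
proof -
  have "\<exists>t u. 0 < t \<and> t < 1 / real (k + 2) \<and> dist u w < 1 / real (k + 2) \<and>
      mpoly_eval (homogenization f) (hcoords (of_real t) u) = 0" for k
    by (rule homogenization_zero_near_infinity[OF assms(1) zero, of "1 / real (k + 2)"]) auto
  then obtain t u where t: "\<And>k. 0 < t k" "\<And>k. t k < 1 / real (k + 2)"
    and u: "\<And>k. dist (u k) w < 1 / real (k + 2)"
    and tu: "\<And>k. mpoly_eval (homogenization f) (hcoords (of_real (t k)) (u k)) = 0"
    by metis
  define y where "y k = Im_vec (u k)" for k
  have y_dist: "dist (y k) (Im_vec w) < 1 / real (k + 2)" for k
    using norm_Im_vec_le[of "u k - w"] u[of k] by (simp add: y_def dist_norm Im_vec_diff)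
  \<comment> \<open>Every error bound is below 1, the norm of \<open>Im_vec w\<close>, so
    normalizing \<open>y k\<close> is possible from \<open>k = 0\<close> on.\<close>
  have y_nonzero: "y k \<noteq> 0" for k
  proof
    assume "y k = 0"
    then have "1 < 1 / real (k + 2)" using y_dist[of k] unit by simp
    then show False by (simp add: field_simps)
  qed
  have lim0: "(\<lambda>k. 1 / real (k + 2)) \<longlonglongrightarrow> 0" by real_asymp
  have y_lim: "y \<longlonglongrightarrow> Im_vec w"
    by (rule metric_tendsto_imp_tendsto[OF lim0])
      (use y_dist in \<open>auto intro!: always_eventually simp: less_imp_le\<close>)
  have t_lim: "t \<longlonglongrightarrow> 0"
    by (rule tendsto_sandwich[OF _ _ tendsto_const lim0])
      (use t in \<open>auto intro!: always_eventually simp: less_imp_le\<close>)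
  \<comment> \<open>This is the norm of the imaginary part of the zero \<open>u k / t k\<close> of
    \<open>f\<close>; it diverges because \<open>norm (y k)\<close> tends to 1 and
    \<open>t k\<close> to 0.\<close>
  define r where "r k = norm (y k) / t k" for k
  define s where "s k = (1 / norm (y k)) *\<^sub>R y k" for k
  have "filterlim (\<lambda>k. inverse (t k)) at_top sequentially"
    using t_lim t(1) by (intro filterlim_inverse_at_top) auto
  then have r_lim: "filterlim r at_top sequentially"
    unfolding r_def divide_inverse using unit
    by (intro filterlim_tendsto_pos_mult_at_top[OF tendsto_norm[OF y_lim]]) auto

  have "s \<longlonglongrightarrow> (1 / norm (Im_vec w)) *\<^sub>R Im_vec w"
    unfolding s_def using unit by (intro tendsto_intros y_lim) auto
  then have s_lim: "s \<longlonglongrightarrow> Im_vec w" by (simp add: unit)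
  have s_mem: "s k \<in> (\<lambda>y. (1 / r k) *\<^sub>R y) ` imaginary_projection f \<inter> sphere 0 1" for k
  proof
    let ?z = "\<chi> i. u k $ i / of_real (t k)"
    have "mpoly_eval f ?z = 0"
      using tu[of k] t(1)[of k] by (simp add: mpoly_eval_homogenization)
    then have "Im_vec ?z \<in> imaginary_projection f"
      unfolding imaginary_projection_def by blast
    moreover have "s k = (1 / r k) *\<^sub>R Im_vec ?z"
      using t(1)[of k] by (simp add: s_def r_def y_def Im_vec_def vec_eq_iff)
    ultimately show "s k \<in> (\<lambda>y. (1 / r k) *\<^sub>R y) ` imaginary_projection f" by blast
    show "s k \<in> sphere 0 1" using y_nonzero[of k] by (simp add: s_def)
  qed
  show ?thesis
    unfolding limit_directions_def using r_lim s_mem s_lim by blast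
qed

theorem theorem6p5:
  fixes f :: "'n::finite mpoly" and p :: "complex ^ 'n"
  assumes nonconst: "\<forall>c. f \<noteq> mpoly_const c"
    and proj_point: "hcoords 0 p \<noteq> 0"
    and zero_at_infinity: "mpoly_eval (homogenization f) (hcoords 0 p) = 0"
  shows "sphere 0 1 \<inter> {l *\<^sub>R Re_vec p + m *\<^sub>R Im_vec p | l m :: real. True}
           \<subseteq> limit_directions f"
proof
  fix q assume "q \<in> sphere 0 1 \<inter> {l *\<^sub>R Re_vec p + m *\<^sub>R Im_vec p | l m :: real. True}"
  then obtain l m where q: "norm q = 1" "q = l *\<^sub>R Re_vec p + m *\<^sub>R Im_vec p"
    by auto
  have "f \<noteq> 0" using nonconst[rule_format, of 0] by (simp add: mpoly_const_def)
  \<comment> \<open>The imaginary part of \<open>(m + i l) (a + i b)\<close> is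
    \<open>l a + m b\<close>, hence the order of \<open>m\<close> and \<open>l\<close>.\<close>
  have "q = Im_vec (Complex m l *s p)"
    by (simp add: q(2) Re_vec_def Im_vec_def vec_eq_iff)
  moreover have "mpoly_eval (homogenization f) (hcoords 0 (Complex m l *s p)) = 0"
    by (simp add: mpoly_eval_homogenization_infinity_scale zero_at_infinity)
  ultimately show "q \<in> limit_directions f"
    using limit_direction_of_zero_at_infinity[OF \<open>f \<noteq> 0\<close>] q(1) by metis
qed

end
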